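(* Let $\varnothing\ne T\subset\mathbb{R}$ and let $(M,d)$ be a metric space. For a sequence $\{f_j\}_{j=1}^\infty\subset M^T$ consider the condition $$( * )\qquad \limsup_{j\to\infty}V_\varepsilon(f_j,T)<\infty\quad\text{for all }\varepsilon>0.$$ (a) Condition $( * )$ is necessary for uniform convergence in the following sense: if $\{f_j\}\subset M^T$, $f_j$ converges uniformly on $T$ to $f$, and $V_\varepsilon(f,T)<\infty$ for all $\varepsilon>0$, then $$\limsup_{j\to\infty}V_\varepsilon(f_j,T)\le V_{\varepsilon-0}(f,T)\le V_{\varepsilon'}(f,T)<\infty\quad\text{for all }0<\varepsilon'<\varepsilon.$$ (b) Contrary to this, condition $( * )$ is not necessary for pointwise convergence (that is, there are sequences $\{f_j\}\subset M^T$ which converge pointwise on $T$ to some $f\in M^T$ but do not satisfy $( * )$). On the other hand, $( * )$ is "almost necessary" for the pointwise convergence $f_j\to f$ on $T$ in the following sense. Assume that $T\subset\mathbb{R}$ is a measurable set with finite Lebesgue measure $\mathcal{L}(T)$, $\{f_j\}\subset M^T$ is a sequence of measurable functions such that $f_j\to f$ pointwise on $T$ (or even $f_j$ converges almost everywhere on $T$ to $f$), and $V_\varepsilon(f,T)<\infty$ for all $\varepsilon>0$. Then, given $\eta>0$, there is (by Egorov's Theorem) a measurable set $T_\eta\subset T$ such that $\mathcal{L}(T\setminus T_\eta)\le\eta$ and $f_j$ converges uniformly to $f$ on $T_\eta$, and we have $$\limsup_{j\to\infty}V_\varepsilon(f_j,T_\eta)\le V_{\varepsilon'}(f,T_\eta)\le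 V_{\varepsilon'}(f,T)<\infty\quad\text{for all }0<\varepsilon'<\varepsilon.$$
   Context: $M^T$ is the set of all functions $f:T\to M$. For nonempty $S\subset T$ and functions $f,g$ defined on $S$ (or on a set containing $S$) put $d_{\infty,S}(f,g)=\sup_{t\in S}d(f(t),g(t))$; uniform convergence of $f_j$ to $f$ on $S$ means $d_{\infty,S}(f_j,f)\to0$ as $j\to\infty$, and pointwise convergence on $T$ means $d(f_j(t),f(t))\to0$ for all $t\in T$. The (Jordan) variation of $g:S\to M$ is $V(g,S)=\sup\sum_{i=1}^m d(g(t_i),g(t_{i-1}))\in[0,\infty]$, the supremum being over all $m\in\mathbb{N}$ and all points $t_0\le t_1\le\dots\le t_m$ of $S$; $\mathrm{BV}(S;M)=\{g\in M^S:V(g,S)<\infty\}$. For $\varepsilon>0$, the $\varepsilon$-variation of $f$ on $S$ is $$V_\varepsilon(f,S)=\inf\{V(g,S):g\in\mathrm{BV}(S;M),\ d_{\infty,S}(f,g)\le\varepsilon\}\in[0,\infty],\qquad \inf\varnothing=\infty.$$ The function $\varepsilon\mapsto V_\varepsilon(f,T)$ is nonincreasing on $(0,\infty)$, and $V_{\varepsilon-0}(f,T)=\lim_{\varepsilon'\to\varepsilon-0}V_{\varepsilon'}(f,T)\in[0,\infty]$ denotes its left limit at $\varepsilon$. *)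

theory Defs
  imports "HOL-Analysis.Analysis"
begin

text \<open>
  A function in \<open>M\<^sup>T\<close> is represented by a total function \<open>real \<Rightarrow> 'm\<close>; every notion below
  only looks at its values on the given set. Suprema and infima are taken in
  \<open>ennreal = [0,\<infinity>]\<close>, so that the infimum of the empty set is \<open>\<infinity>\<close>, and over the empty domain
  \<open>d_sup\<close>, \<open>variation\<close> and \<open>eps_variation\<close> are all \<open>0\<close>.
\<close>

definition d_sup :: "real set \<Rightarrow> (real \<Rightarrow> 'm::metric_space) \<Rightarrow> (real \<Rightarrow> 'm) \<Rightarrow> ennreal" where
  "d_sup S f g = (SUP t\<in>S. ennreal (dist (f t) (g t)))"

definition variation :: "(real \<Rightarrow> 'm::metric_space) \<Rightarrow> real set \<Rightarrow> ennreal" where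
  "variation g S =
     (SUP (m, t) \<in> {(m::nat, t::nat \<Rightarrow> real).
                      1 \<le> m \<and> (\<forall>i\<le>m. t i \<in> S) \<and> (\<forall>i<m. t i \<le> t (Suc i))}.
        \<Sum>i=1..m. ennreal (dist (g (t i)) (g (t (i - 1)))))"

definition BV :: "real set \<Rightarrow> (real \<Rightarrow> 'm::metric_space) set" where
  "BV S = {g. variation g S < \<infinity>}"

definition eps_variation :: "real \<Rightarrow> (real \<Rightarrow> 'm::metric_space) \<Rightarrow> real set \<Rightarrow> ennreal" where
  "eps_variation \<epsilon> f S = (INF g \<in> {g \<in> BV S. d_sup S f g \<le> ennreal \<epsilon>}. variation g S)"

definition eps_variation_left :: "real \<Rightarrow> (real \<Rightarrow> 'm::metric_space) \<Rightarrow> real set \<Rightarrow> ennreal" where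
  "eps_variation_left \<epsilon> f S = Lim (at_left \<epsilon>) (\<lambda>\<epsilon>'. eps_variation \<epsilon>' f S)"

definition limsup_eps_variation_finite ::
    "(nat \<Rightarrow> real \<Rightarrow> 'm::metric_space) \<Rightarrow> real set \<Rightarrow> bool" where
  "limsup_eps_variation_finite F S \<longleftrightarrow>
     (\<forall>\<epsilon>>0. limsup (\<lambda>j. eps_variation \<epsilon> (F j) S) < \<infinity>)"

lemma uniform_limit_iff_d_sup:
  "uniform_limit S F f sequentially \<longleftrightarrow> (\<lambda>j. d_sup S (F j) f) \<longlonglongrightarrow> 0"
proof
  assume u: "uniform_limit S F f sequentially"
  show "(\<lambda>j. d_sup S (F j) f) \<longlonglongrightarrow> 0"
  proof (rule order_tendstoI)
    fix a :: ennreal assume "a < 0"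
    then show "\<forall>\<^sub>F j in sequentially. a < d_sup S (F j) f" by simp
  next
    fix a :: ennreal assume "0 < a"
    then obtain b where b: "0 < b" "b < a" using dense by blast
    then have "b < top" by (metis order_less_le_trans top_greatest)
    then obtain e where e: "b = ennreal e" "0 \<le> e" by (cases b) auto
    have "0 < e" using b e by auto
    with u have "\<forall>\<^sub>F j in sequentially. \<forall>x\<in>S. dist (F j x) (f x) < e"
      by (auto simp: uniform_limit_iff)
    then show "\<forall>\<^sub>F j in sequentially. d_sup S (F j) f < a"
    proof eventually_elim
      case (elim j)
      have "d_sup S (F j) f \<le> b"
        unfolding d_sup_def e(1) using elim by (intro SUP_least ennreal_leI) (simp add: less_imp_le)
      with b show ?case by simp
    qed
  qed
next
  assume l: "(\<lambda>j. d_sup S (F j) f) \<longlonglongrightarrow> 0"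
  show "uniform_limit S F f sequentially"
    unfolding uniform_limit_iff
  proof (intro allI impI)
    fix e :: real assume "e > 0"
    then have "0 < ennreal e" by simp
    with l have "\<forall>\<^sub>F j in sequentially. d_sup S (F j) f < ennreal e"
      by (rule order_tendstoD(2))
    then show "\<forall>\<^sub>F j in sequentially. \<forall>x\<in>S. dist (F j x) (f x) < e"
    proof eventually_elim
      case (elim j)
      show ?case
      proof
        fix x assume "x \<in> S"
        then have "ennreal (dist (F j x) (f x)) \<le> d_sup S (F j) f"
          unfolding d_sup_def by (rule SUP_upper)
        with elim have "ennreal (dist (F j x) (f x)) < ennreal e" by simp
        then show "dist (F j x) (f x) < e" using \<open>e > 0\<close> by (simp add: ennreal_less_iff)
      qed
    qed
  qed
qed

lemma eps_variation_antimono: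
  assumes "\<epsilon>' \<le> \<epsilon>"
  shows "eps_variation \<epsilon> f S \<le> eps_variation \<epsilon>' f S"
  unfolding eps_variation_def
  using assms by (intro INF_superset_mono) (auto intro: order_trans ennreal_leI)

lemma tendsto_eps_variation_left:
  "((\<lambda>\<epsilon>'. eps_variation \<epsilon>' f S) \<longlongrightarrow> eps_variation_left \<epsilon> f S) (at_left \<epsilon>)"
proof -
  let ?V = "\<lambda>\<epsilon>'. eps_variation \<epsilon>' f S"
  have "(?V \<longlongrightarrow> (INF \<epsilon>'\<in>{..<\<epsilon>}. ?V \<epsilon>')) (at_left \<epsilon>)"
  proof (rule decreasing_tendsto)
    show "\<forall>\<^sub>F \<epsilon>' in at_left \<epsilon>. (INF \<epsilon>'\<in>{..<\<epsilon>}. ?V \<epsilon>') \<le> ?V \<epsilon>'"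
      by (auto simp: eventually_at_filter intro!: always_eventually INF_lower)
  next
    fix x assume "(INF \<epsilon>'\<in>{..<\<epsilon>}. ?V \<epsilon>') < x"
    then obtain c where c: "c < \<epsilon>" "?V c < x" by (auto simp: INF_less_iff)
    show "\<forall>\<^sub>F \<epsilon>' in at_left \<epsilon>. ?V \<epsilon>' < x"
      using eventually_at_left_real[OF c(1)]
    proof eventually_elim
      case (elim e)
      then have "?V e \<le> ?V c" by (intro eps_variation_antimono) simp
      with c(2) show ?case by simp
    qed
  qed
  moreover from this have "eps_variation_left \<epsilon> f S = (INF \<epsilon>'\<in>{..<\<epsilon>}. ?V \<epsilon>')"
    unfolding eps_variation_left_def by (intro tendsto_Lim) auto
  ultimately show ?thesis by simp
qed

end

theory Submission
  imports Defs
begin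

text \<open>
  Everything rests on one perturbation inequality: if \<open>h\<close> stays within \<open>\<delta>\<close> of \<open>f\<close> on \<open>S\<close>, then
  every function approximating \<open>f\<close> up to \<open>\<epsilon>'\<close> approximates \<open>h\<close> up to \<open>\<epsilon>' + \<delta>\<close>, so
  the \<open>(\<epsilon>' + \<delta>)\<close>-variation of \<open>h\<close> is at most the \<open>\<epsilon>'\<close>-variation of \<open>f\<close>
  (\<open>eps_variation_perturb\<close>). Under uniform convergence it applies with \<open>\<delta> = \<epsilon> - \<epsilon>'\<close>
  to all late \<open>F j\<close>; letting \<open>\<epsilon>'\<close> increase to \<open>\<epsilon>\<close> gives the left limit as a bound.

  A function whose consecutive values along some monotone sequence of points eventually differ by
  at least \<open>c > 2\<epsilon>\<close> has infinite \<open>\<epsilon>\<close>-variation, because every \<open>\<epsilon>\<close>-approximation still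
  jumps by at least \<open>c - 2\<epsilon>\<close> infinitely often (\<open>eps_variation_infinite\<close>). This fact is used
  twice. First, it yields pointwise convergent sequences whose \<open>\<epsilon>\<close>-variations are all infinite
  for a small enough \<open>\<epsilon>\<close>: along an injective monotone sequence in \<open>T\<close>, let the \<open>j\<close>-th function
  alternate between two values from index \<open>j\<close> on, and be constant elsewhere. Second, since every
  real sequence has a monotone subsequence, finiteness of all \<open>\<epsilon>\<close>-variations of \<open>f\<close> on \<open>T\<close>
  forces \<open>f ` T\<close> to be totally bounded, hence separable.

  Separability is what makes Egorov's theorem available for functions with values in an arbitrary
  metric space: in general the distance of two Borel functions need not be measurable, but it is
  when one of them has separable range (\<open>borel_measurable_dist_separable_range\<close>). Egorov's theorem
  is then applied to the real functions \<open>dist (F j t) (f t)\<close>, and on the resulting set the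
  convergence is uniform, so that the first part applies there.
\<close>

section \<open>Perturbing the function and shrinking the domain\<close>

lemma variation_mono_set: "S \<subseteq> S' \<Longrightarrow> variation g S \<le> variation g S'"
  unfolding variation_def by (rule SUP_subset_mono) auto

lemma eps_variation_mono_set:
  assumes "S \<subseteq> S'"
  shows "eps_variation \<epsilon> f S \<le> eps_variation \<epsilon> f S'"
proof -
  have dsup: "d_sup S f g \<le> d_sup S' f g" for g
    unfolding d_sup_def using assms by (rule SUP_subset_mono) simp
  show ?thesis
    unfolding eps_variation_def
  proof (rule INF_mono, intro bexI)
    fix g assume g: "g \<in> {g \<in> BV S'. d_sup S' f g \<le> ennreal \<epsilon>}"
    show "variation g S \<le> variation g S'" by (rule variation_mono_set[OF assms])
    with g dsup[of g] show "g \<in> {g \<in> BV S. d_sup S f g \<le> ennreal \<epsilon>}"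
      by (auto simp: BV_def)
  qed
qed

lemma d_sup_le_iff: "0 \<le> \<epsilon> \<Longrightarrow> d_sup S f g \<le> ennreal \<epsilon> \<longleftrightarrow> (\<forall>t\<in>S. dist (f t) (g t) \<le> \<epsilon>)"
  unfolding d_sup_def by (simp add: SUP_le_iff)

lemma eps_variation_perturb:
  assumes "0 \<le> \<epsilon>'" "0 \<le> \<delta>" and close: "\<And>t. t \<in> S \<Longrightarrow> dist (h t) (f t) \<le> \<delta>"
  shows "eps_variation (\<epsilon>' + \<delta>) h S \<le> eps_variation \<epsilon>' f S"
  unfolding eps_variation_def
proof (rule INF_superset_mono)
  show "{g \<in> BV S. d_sup S f g \<le> ennreal \<epsilon>'} \<subseteq> {g \<in> BV S. d_sup S h g \<le> ennreal (\<epsilon>' + \<delta>)}"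
  proof safe
    fix g assume "d_sup S f g \<le> ennreal \<epsilon>'"
    then have g: "\<forall>t\<in>S. dist (f t) (g t) \<le> \<epsilon>'" using assms by (simp add: d_sup_le_iff)
    have "dist (h t) (g t) \<le> \<epsilon>' + \<delta>" if "t \<in> S" for t
      using dist_triangle[of "h t" "g t" "f t"] close[OF that] g that by fastforce
    then show "d_sup S h g \<le> ennreal (\<epsilon>' + \<delta>)"
      using assms(1,2) by (subst d_sup_le_iff) auto
  qed
qed simp

lemma limsup_eps_variation_le:
  assumes unif: "uniform_limit S F f sequentially" and "0 < \<epsilon>'" "\<epsilon>' < \<epsilon>"
  shows "limsup (\<lambda>j. eps_variation \<epsilon> (F j) S) \<le> eps_variation \<epsilon>' f S"
proof (rule Limsup_bounded)
  have "\<forall>\<^sub>F j in sequentially. \<forall>t\<in>S. dist (F j t) (f t) < \<epsilon> - \<epsilon>'"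
    using unif \<open>\<epsilon>' < \<epsilon>\<close> by (simp add: uniform_limit_iff)
  then show "\<forall>\<^sub>F j in sequentially. eps_variation \<epsilon> (F j) S \<le> eps_variation \<epsilon>' f S"
  proof eventually_elim
    case (elim j)
    then show ?case
      using eps_variation_perturb[of \<epsilon>' "\<epsilon> - \<epsilon>'" S "F j" f] assms by (simp add: less_imp_le)
  qed
qed

lemma eps_variation_left_le:
  assumes "\<epsilon>' < \<epsilon>"
  shows "eps_variation_left \<epsilon> f S \<le> eps_variation \<epsilon>' f S"
proof (rule tendsto_upperbound[OF tendsto_eps_variation_left])
  show "\<forall>\<^sub>F e in at_left \<epsilon>. eps_variation e f S \<le> eps_variation \<epsilon>' f S"
    using eventually_at_left_real[OF assms]
    by eventually_elim (auto intro: eps_variation_antimono)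
qed simp

lemma limsup_eps_variation_le_left:
  assumes "uniform_limit S F f sequentially" "0 < \<epsilon>"
  shows "limsup (\<lambda>j. eps_variation \<epsilon> (F j) S) \<le> eps_variation_left \<epsilon> f S"
proof (rule tendsto_lowerbound[OF tendsto_eps_variation_left])
  show "\<forall>\<^sub>F e in at_left \<epsilon>. limsup (\<lambda>j. eps_variation \<epsilon> (F j) S) \<le> eps_variation e f S"
    using eventually_at_left_real[OF assms(2)]
    by eventually_elim (auto intro: limsup_eps_variation_le[OF assms(1)])
qed simp

section \<open>Oscillation along a monotone sequence\<close>

text \<open>
  The partition points must increase, so a decreasing sequence is read backwards over a finite
  window of length \<open>m\<close>. The starting index \<open>j\<close> is a parameter so that the functions in the
  counterexample below may start oscillating later and later.
\<close>
lemma variation_infinite: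
  assumes mono: "monoseq s" and S: "\<And>n. s n \<in> S" and "0 < c"
    and osc: "\<And>n. j \<le> n \<Longrightarrow> c \<le> dist (g (s n)) (g (s (Suc n)))"
  shows "variation g S = \<infinity>"
proof -
  have bound: "ennreal (real m * c) \<le> variation g S" if "1 \<le> m" for m
  proof -
    consider "incseq s" | "decseq s" using mono by (auto simp: monoseq_iff)
    then obtain t where t: "\<forall>i\<le>m. t i \<in> S" "\<forall>i<m. t i \<le> t (Suc i)"
      and d: "\<And>i. i \<in> {1..m} \<Longrightarrow> c \<le> dist (g (t i)) (g (t (i - 1)))"
    proof cases
      case 1
      have "c \<le> dist (g (s (j + i))) (g (s (j + (i - 1))))" if "i \<in> {1..m}" for i
        using osc[of "j + (i - 1)"] that by (simp add: dist_commute)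
      with 1 S show ?thesis by (intro that[of "\<lambda>i. s (j + i)"]) (auto simp: incseq_SucD)
    next
      case 2
      have "c \<le> dist (g (s (j + (m - i)))) (g (s (j + (m - (i - 1)))))" if "i \<in> {1..m}" for i
      proof -
        have "j + (m - (i - 1)) = Suc (j + (m - i))" using that by auto
        then show ?thesis using osc[of "j + (m - i)"] by simp
      qed
      moreover have "\<forall>i<m. s (j + (m - i)) \<le> s (j + (m - Suc i))"
        by (intro allI impI decseqD[OF 2]) simp
      ultimately show ?thesis
        using S by (intro that[of "\<lambda>i. s (j + (m - i))"]) blast+
    qed
    have "ennreal (real m * c) = (\<Sum>i=1..m. ennreal c)"
      by (simp add: ennreal_mult'' ennreal_of_nat_eq_real_of_nat \<open>0 < c\<close>[THEN less_imp_le])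
    also have "\<dots> \<le> (\<Sum>i=1..m. ennreal (dist (g (t i)) (g (t (i - 1)))))"
      using d by (intro sum_mono ennreal_leI) auto
    also have "\<dots> \<le> variation g S"
      unfolding variation_def using t \<open>1 \<le> m\<close> by (intro SUP_upper2[of "(m, t)"]) auto
    finally show ?thesis .
  qed
  show ?thesis
  proof (rule ccontr)
    assume "variation g S \<noteq> \<infinity>"
    then obtain r where r: "variation g S = ennreal r" "0 \<le> r"
      by (cases "variation g S") auto
    obtain m :: nat where m: "r / c < real m" using reals_Archimedean2 by blast
    have "r < real m * c" using m \<open>0 < c\<close> by (simp add: field_simps)
    moreover have "1 \<le> m" using m r \<open>0 < c\<close> by (cases m) (auto simp: field_simps)
    ultimately show False using bound[of m] r by simp
  qed
qed

text \<open>
  An approximation within \<open>\<epsilon>\<close> can shrink each jump of \<open>f\<close> by at most \<open>2\<epsilon>\<close>. Hence no function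
  of bounded variation is within \<open>\<epsilon>\<close> of \<open>f\<close>, and the infimum is taken over the empty set.
\<close>
lemma eps_variation_infinite:
  assumes "monoseq s" and S: "\<And>n. s n \<in> S" and "0 \<le> \<epsilon>" "2 * \<epsilon> < c"
    and osc: "\<And>n. j \<le> n \<Longrightarrow> c \<le> dist (f (s n)) (f (s (Suc n)))"
  shows "eps_variation \<epsilon> f S = \<infinity>"
proof -
  have "variation g S = \<infinity>" if "d_sup S f g \<le> ennreal \<epsilon>" for g
  proof (rule variation_infinite[OF assms(1) S])
    show "0 < c - 2 * \<epsilon>" using assms by simp
    fix n assume "j \<le> n"
    have g: "\<forall>t\<in>S. dist (f t) (g t) \<le> \<epsilon>" using that \<open>0 \<le> \<epsilon>\<close> by (simp add: d_sup_le_iff)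
    let ?p = "s n" and ?q = "s (Suc n)"
    have "dist (f ?p) (f ?q) \<le> dist (f ?p) (g ?p) + dist (g ?p) (g ?q) + dist (f ?q) (g ?q)"
      by metric
    moreover have "dist (f ?p) (g ?p) \<le> \<epsilon>" "dist (f ?q) (g ?q) \<le> \<epsilon>" using g S by auto
    ultimately show "c - 2 * \<epsilon> \<le> dist (g ?p) (g ?q)" using osc[OF \<open>j \<le> n\<close>] by linarith
  qed
  then have "{g \<in> BV S. d_sup S f g \<le> ennreal \<epsilon>} = {}" by (auto simp: BV_def)
  then show ?thesis
    unfolding eps_variation_def by (simp only: image_empty Inf_empty infinity_ennreal_def)
qed

text \<open>
  Each \<open>F j\<close> oscillates between \<open>x\<close> and \<open>y\<close> from index \<open>j\<close> on, while a fixed point of the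
  sequence is left behind once \<open>j\<close> exceeds its index, which gives pointwise convergence to \<open>x\<close>.
\<close>
lemma pointwise_limit_infinite_eps_variation:
  fixes x y :: "'m::metric_space"
  assumes "infinite T" "x \<noteq> y"
  shows "\<exists>(F :: nat \<Rightarrow> real \<Rightarrow> 'm) f.
           (\<forall>t\<in>T. (\<lambda>j. F j t) \<longlonglongrightarrow> f t) \<and> \<not> limsup_eps_variation_finite F T"
proof -
  obtain s0 :: "nat \<Rightarrow> real" where s0: "inj s0" "range s0 \<subseteq> T"
    using assms(1) infinite_countable_subset by blast
  obtain r where r: "strict_mono r" "monoseq (\<lambda>n. s0 (r n))"
    using seq_monosub by blast
  define s where "s n = s0 (r n)" for n
  have s: "monoseq s" "\<And>n. s n \<in> T" "inj s"
    using r s0 inj_compose[OF s0(1) strict_mono_imp_inj_on[OF r(1)]]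
    by (auto simp: s_def[abs_def] comp_def)
  define F where "F j t = (if t \<in> s ` {n. j \<le> n \<and> even n} then y else x)" for j t
  have F_s: "F j (s n) = (if j \<le> n \<and> even n then y else x)" for j n
    using s(3) by (auto simp: F_def inj_on_def)
  have "(\<lambda>j. F j t) \<longlonglongrightarrow> x" for t
  proof (rule tendsto_eventually)
    show "\<forall>\<^sub>F j in sequentially. F j t = x"
    proof (cases "t \<in> range s")
      case True
      then obtain n where t: "t = s n" by auto
      show ?thesis
        using eventually_gt_at_top[of n] by eventually_elim (simp add: t F_s)
    next
      case False
      then have "F j t = x" for j by (auto simp: F_def)
      then show ?thesis by simp
    qed
  qed
  moreover have "eps_variation (dist x y / 3) (F j) T = \<infinity>" for j
    using s(1,2) by (rule eps_variation_infinite[where c = "dist x y" and j = j])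
      (use assms(2) in \<open>auto simp: F_s dist_commute\<close>)
  then have "\<not> limsup_eps_variation_finite F T"
    unfolding limsup_eps_variation_finite_def using assms(2)
    by (intro notI, elim allE[of _ "dist x y / 3"]) (simp add: Limsup_const)
  ultimately show ?thesis by (intro exI[of _ F] exI[of _ "\<lambda>_. x"]) simp
qed

text \<open>
  Without a finite \<open>c\<close>-net one could choose points whose values under \<open>f\<close> are pairwise at
  distance at least \<open>c\<close>. A monotone subsequence of these points would then make the
  \<open>\<epsilon>\<close>-variation infinite.
\<close>
lemma finite_net_if_eps_variation_finite:
  assumes "0 \<le> \<epsilon>" "2 * \<epsilon> < c" and fin: "eps_variation \<epsilon> f S < \<infinity>"
  shows "\<exists>K. finite K \<and> (\<forall>t\<in>S. \<exists>q\<in>K. dist (f t) q < c)"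
proof (rule ccontr)
  assume "\<not> ?thesis"
  then have none: "\<exists>t\<in>S. \<forall>q\<in>K. c \<le> dist (f t) q" if "finite K" for K
    using that by (auto simp: not_less)
  let ?Q = "\<lambda>x n t. t \<in> S \<and> (\<forall>m<n::nat. c \<le> dist (f t) (f (x m)))"
  have "\<exists>x. \<forall>n::nat. ?Q x n (x n)"
  proof (rule dependent_wellorder_choice)
    fix n and x :: "nat \<Rightarrow> real"
    show "\<exists>t. ?Q x n t" using none[of "(\<lambda>m. f (x m)) ` {..<n}"] by auto
  qed simp
  then obtain x :: "nat \<Rightarrow> real" where x: "\<And>n. x n \<in> S" "\<And>m n. m < n \<Longrightarrow> c \<le> dist (f (x n)) (f (x m))"
    by blast
  obtain r where r: "strict_mono r" "monoseq (\<lambda>n. x (r n))"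
    using seq_monosub by blast
  have "eps_variation \<epsilon> f S = \<infinity>"
  proof (rule eps_variation_infinite[OF r(2) x(1) assms(1,2)])
    fix n
    have "r n < r (Suc n)" using r(1) by (rule strict_monoD) simp
    then show "c \<le> dist (f (x (r n))) (f (x (r (Suc n))))"
      using x(2) by (subst dist_commute) blast
  qed
  with fin show False by simp
qed

lemma countable_dense_if_eps_variation_finite:
  assumes fin: "\<And>\<epsilon>. 0 < \<epsilon> \<Longrightarrow> eps_variation \<epsilon> f S < \<infinity>"
  obtains Q where "countable Q" "\<And>t e. t \<in> S \<Longrightarrow> 0 < e \<Longrightarrow> \<exists>q\<in>Q. dist (f t) q < e"
proof -
  have "\<exists>K. finite K \<and> (\<forall>t\<in>S. \<exists>q\<in>K. dist (f t) q < inverse (real (Suc n)))" for n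
    by (rule finite_net_if_eps_variation_finite[OF _ _ fin[of "inverse (real (Suc n)) / 3"]]) auto
  then obtain K where K: "\<And>n. finite (K n)"
      "\<And>n t. t \<in> S \<Longrightarrow> \<exists>q\<in>K n. dist (f t) q < inverse (real (Suc n))"
    using choice[of "\<lambda>n K. finite K \<and> (\<forall>t\<in>S. \<exists>q\<in>K. dist (f t) q < inverse (real (Suc n)))"]
    by blast
  show ?thesis
  proof (rule that[of "\<Union>n. K n"])
    show "countable (\<Union>n. K n)" using K(1) by (auto intro: countable_finite)
    fix t and e :: real assume "t \<in> S" "0 < e"
    obtain n where "inverse (real (Suc n)) < e"
      using \<open>0 < e\<close> reals_Archimedean by blast
    moreover obtain q where "q \<in> K n" "dist (f t) q < inverse (real (Suc n))"
      using K(2)[OF \<open>t \<in> S\<close>] by blast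
    ultimately show "\<exists>q\<in>(\<Union>n. K n). dist (f t) q < e"
      by (intro bexI[of _ q]) auto
  qed
qed

section \<open>Egorov's theorem for a limit with separable range\<close>

text \<open>
  For an inseparable target the Borel sets of the product can be strictly larger than the product
  of the Borel sets, so measurability of \<open>dist\<close> on pairs is not automatic. With \<open>Q\<close> accumulating
  at all values of \<open>v\<close>, the distance is a countable infimum of sums of distances to fixed points.
\<close>
lemma borel_measurable_dist_separable_range:
  fixes u v :: "'a \<Rightarrow> 'm::metric_space"
  assumes u: "u \<in> borel_measurable M" and v: "v \<in> borel_measurable M"
    and "countable Q"
    and dense: "\<And>x e. x \<in> space M \<Longrightarrow> 0 < e \<Longrightarrow> \<exists>q\<in>Q. dist (v x) q < e"
  shows "(\<lambda>x. dist (u x) (v x)) \<in> borel_measurable M"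
proof -
  have dist_const: "(\<lambda>x. dist (w x) q) \<in> borel_measurable M"
    if "w \<in> borel_measurable M" for w :: "'a \<Rightarrow> 'm" and q
    by (rule measurable_compose[OF that borel_measurable_continuous_onI]) (intro continuous_intros)
  have "(\<lambda>x. INF q\<in>Q. dist (u x) q + dist (v x) q) \<in> borel_measurable M"
    by (intro borel_measurable_cINF_real \<open>countable Q\<close> borel_measurable_add dist_const u v)
  moreover have "(INF q\<in>Q. dist (u x) q + dist (v x) q) = dist (u x) (v x)" if x: "x \<in> space M" for x
  proof (rule cInf_eq_non_empty)
    show "(\<lambda>q. dist (u x) q + dist (v x) q) ` Q \<noteq> {}" using dense[OF x, of 1] by auto
    show "dist (u x) (v x) \<le> z" if "z \<in> (\<lambda>q. dist (u x) q + dist (v x) q) ` Q" for z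
      using that by (auto simp: dist_triangle2)
    fix z assume z: "\<And>w. w \<in> (\<lambda>q. dist (u x) q + dist (v x) q) ` Q \<Longrightarrow> z \<le> w"
    show "z \<le> dist (u x) (v x)"
    proof (rule field_le_epsilon)
      fix e :: real assume "0 < e"
      then obtain q where q: "q \<in> Q" "dist (v x) q < e / 2" using dense[OF x, of "e / 2"] by auto
      then have "z \<le> dist (u x) q + dist (v x) q" using z by auto
      also have "\<dots> \<le> dist (u x) (v x) + 2 * dist (v x) q" by metric
      finally show "z \<le> dist (u x) (v x) + e" using q by simp
    qed
  qed
  ultimately show ?thesis
    by (subst measurable_cong[where g = "\<lambda>x. INF q\<in>Q. dist (u x) q + dist (v x) q"]) auto
qed

text \<open>
  For each threshold \<open>1/(k+1)\<close>, the sets where it is exceeded after time \<open>n\<close> decrease to the empty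
  set; by finiteness of the measure their measures tend to \<open>0\<close>. Removing one of measure at most
  \<open>\<eta>/2^(k+1)\<close> for each \<open>k\<close> leaves a set of uniform convergence.
\<close>
lemma Egorov_real:
  fixes h :: "nat \<Rightarrow> 'a \<Rightarrow> real"
  assumes fin: "emeasure M (space M) \<noteq> \<infinity>"
    and meas: "\<And>j. h j \<in> borel_measurable M"
    and lim: "\<And>x. x \<in> space M \<Longrightarrow> (\<lambda>j. h j x) \<longlonglongrightarrow> 0" and "0 < \<eta>"
  obtains B where "B \<in> sets M" "emeasure M (space M - B) \<le> ennreal \<eta>"
    "uniform_limit B h (\<lambda>_. 0) sequentially"
proof -
  note [measurable] = meas
  define A where "A k n = {x \<in> space M. \<exists>j\<ge>n. inverse (real (Suc k)) \<le> \<bar>h j x\<bar>}" for k n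
  have A[measurable]: "A k n \<in> sets M" for k n unfolding A_def by measurable
  have "\<exists>n. emeasure M (A k n) < ennreal (\<eta> * (1/2) ^ Suc k)" for k
  proof -
    have "(\<Inter>n. A k n) = {}"
    proof safe
      fix x assume x: "x \<in> (\<Inter>n. A k n)"
      then have "x \<in> space M" by (auto simp: A_def)
      then have "\<forall>\<^sub>F j in sequentially. \<bar>h j x\<bar> < inverse (real (Suc k))"
        using tendstoD[OF lim, of x "inverse (real (Suc k))"] by (simp add: dist_real_def)
      then obtain n where "\<And>j. n \<le> j \<Longrightarrow> \<bar>h j x\<bar> < inverse (real (Suc k))"
        by (auto simp: eventually_sequentially)
      then have "x \<notin> A k n" by (force simp: A_def)
      with x show "x \<in> {}" by auto
    qed
    moreover have "(\<lambda>n. emeasure M (A k n)) \<longlonglongrightarrow> emeasure M (\<Inter>n. A k n)"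
    proof (rule Lim_emeasure_decseq)
      show "decseq (A k)" by (auto simp: decseq_def A_def intro: order_trans)
      show "emeasure M (A k n) \<noteq> \<infinity>" for n
        using emeasure_mono[of "A k n" "space M" M] fin by (auto simp: A_def top_unique)
    qed auto
    ultimately have "(\<lambda>n. emeasure M (A k n)) \<longlonglongrightarrow> 0" by simp
    then have "\<forall>\<^sub>F n in sequentially. emeasure M (A k n) < ennreal (\<eta> * (1/2) ^ Suc k)"
      by (rule order_tendstoD) (use \<open>0 < \<eta>\<close> in simp)
    then show ?thesis by (auto simp: eventually_sequentially)
  qed
  then obtain N where N: "\<And>k. emeasure M (A k (N k)) < ennreal (\<eta> * (1/2) ^ Suc k)" by metis
  show ?thesis
  proof (rule that)
    let ?E = "\<Union>k. A k (N k)"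
    show "space M - ?E \<in> sets M" by measurable
    have "emeasure M (space M - (space M - ?E)) = emeasure M ?E"
      by (rule arg_cong[where f = "emeasure M"]) (auto simp: A_def)
    also have "\<dots> \<le> (\<Sum>k. emeasure M (A k (N k)))"
      by (rule emeasure_subadditive_countably) auto
    also have "\<dots> \<le> (\<Sum>k. ennreal (\<eta> * (1/2) ^ Suc k))"
      by (intro suminf_le less_imp_le N) auto
    also have "\<dots> = ennreal \<eta>"
      using sums_mult[OF power_half_series, of \<eta>] \<open>0 < \<eta>\<close> by (intro suminf_ennreal_eq) auto
    finally show "emeasure M (space M - (space M - ?E)) \<le> ennreal \<eta>" .
    show "uniform_limit (space M - ?E) h (\<lambda>_. 0) sequentially"
      unfolding uniform_limit_iff
    proof (intro allI impI)
      fix e :: real assume "0 < e"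
      then obtain k where k: "inverse (real (Suc k)) < e" using reals_Archimedean by blast
      show "\<forall>\<^sub>F j in sequentially. \<forall>x\<in>space M - ?E. dist (h j x) 0 < e"
        using eventually_ge_at_top[of "N k"]
      proof eventually_elim
        case (elim j)
        show ?case
        proof
          fix x assume "x \<in> space M - ?E"
          then have "x \<in> space M" "x \<notin> A k (N k)" by auto
          with elim have "\<bar>h j x\<bar> < inverse (real (Suc k))" unfolding A_def by (fastforce simp: not_le)
          with k show "dist (h j x) 0 < e" by simp
        qed
      qed
    qed
  qed
qed

text \<open>
  The limit \<open>f\<close> is measurable off a null set, being there a pointwise limit of the \<open>F j\<close>; the
  argument is therefore carried out on the complement \<open>T'\<close> of that null set in \<open>T\<close>, where
  \<open>f\<close> has separable range because its \<open>\<epsilon>\<close>-variations on \<open>T\<close> are finite.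
\<close>
lemma Egorov_finite_eps_variation:
  fixes F :: "nat \<Rightarrow> real \<Rightarrow> 'm::metric_space"
  assumes T: "T \<in> sets lebesgue" "emeasure lebesgue T < \<infinity>"
    and meas: "\<And>j. F j \<in> borel_measurable (lebesgue_on T)"
    and lim: "AE t in lebesgue_on T. (\<lambda>j. F j t) \<longlonglongrightarrow> f t"
    and fin: "\<And>\<epsilon>. 0 < \<epsilon> \<Longrightarrow> eps_variation \<epsilon> f T < \<infinity>" and "0 < \<eta>"
  obtains B where "B \<in> sets lebesgue" "B \<subseteq> T" "emeasure lebesgue (T - B) \<le> ennreal \<eta>"
    "uniform_limit B F f sequentially"
proof -
  have ae: "AE t in lebesgue. t \<in> T \<longrightarrow> (\<lambda>j. F j t) \<longlonglongrightarrow> f t"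
    using lim T by (simp add: AE_restrict_space_iff)
  obtain N where N0: "\<And>t. t \<in> space lebesgue - N \<Longrightarrow> t \<in> T \<longrightarrow> (\<lambda>j. F j t) \<longlonglongrightarrow> f t"
    and null: "N \<in> null_sets lebesgue"
    using AE_E3[OF ae] by blast
  have N: "(\<lambda>j. F j t) \<longlonglongrightarrow> f t" if "t \<in> T" "t \<notin> N" for t using N0 that by simp
  define T' where "T' = T - N"
  define M where "M = lebesgue_on T'"
  have T': "T' \<in> sets lebesgue" "T' \<subseteq> T" using T null by (auto simp: T'_def)
  have space: "space M = T'" by (simp add: M_def)
  have emeasure_M: "emeasure M A = emeasure lebesgue A" if "A \<subseteq> T'" for A
    unfolding M_def by (rule emeasure_restrict_space) (use T' that in auto)
  have F: "F j \<in> borel_measurable M" for j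
    using measurable_restrict_mono[OF meas T'(2)] by (simp add: M_def)
  have lim': "(\<lambda>j. F j t) \<longlonglongrightarrow> f t" if "t \<in> T'" for t using N that by (auto simp: T'_def)
  have f: "f \<in> borel_measurable M"
    using F lim' by (rule borel_measurable_LIMSEQ_metric) (simp add: space)
  obtain Q where Q: "countable Q" "\<And>t e. t \<in> T \<Longrightarrow> 0 < e \<Longrightarrow> \<exists>q\<in>Q. dist (f t) q < e"
    using countable_dense_if_eps_variation_finite[OF fin] by blast
  have dist_meas: "(\<lambda>t. dist (F j t) (f t)) \<in> borel_measurable M" for j
    using F f Q(1) by (rule borel_measurable_dist_separable_range) (use Q(2) T' space in auto)
  have "emeasure M (space M) \<le> emeasure lebesgue T"
    unfolding space emeasure_M[OF order_refl] using T'(2) T(1) by (rule emeasure_mono)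
  then have finM: "emeasure M (space M) \<noteq> \<infinity>" using T(2) by (auto simp: top_unique)
  have dist_lim: "(\<lambda>j. dist (F j t) (f t)) \<longlonglongrightarrow> 0" if "t \<in> space M" for t
    using lim'[of t] that tendsto_dist_iff[of "\<lambda>j. F j t" "f t" sequentially] by (simp add: space)
  obtain B where B: "B \<in> sets M" "emeasure M (space M - B) \<le> ennreal \<eta>"
    "uniform_limit B (\<lambda>j t. dist (F j t) (f t)) (\<lambda>_. 0) sequentially"
    using Egorov_real[OF finM dist_meas dist_lim \<open>0 < \<eta>\<close>] by blast
  have B': "B \<in> sets lebesgue" "B \<subseteq> T'"
    using B(1) T'(1) by (auto simp: M_def sets_restrict_space_iff)
  show ?thesis
  proof (rule that[OF B'(1)])
    show "B \<subseteq> T" using B' T' by auto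
    have "emeasure lebesgue (T - B) \<le> emeasure lebesgue ((T' - B) \<union> N)"
      using B' T' null by (intro emeasure_mono) (auto simp: T'_def)
    also have "\<dots> = emeasure lebesgue (T' - B)"
      using B' T' null by (intro emeasure_Un_null_set) auto
    also have "\<dots> = emeasure M (space M - B)"
      unfolding space by (rule emeasure_M[symmetric]) simp
    finally show "emeasure lebesgue (T - B) \<le> ennreal \<eta>" using B(2) by simp
    show "uniform_limit B F f sequentially" using B(3) by (simp add: uniform_limit_iff)
  qed
qed

section \<open>The necessity theorem\<close>

theorem mainTheorem6:
  fixes T :: "real set"
  assumes "T \<noteq> {}"
  shows
    "(\<forall>(F :: nat \<Rightarrow> real \<Rightarrow> 'm::metric_space) f.
        uniform_limit T F f sequentially \<and> (\<forall>\<epsilon>>0. eps_variation \<epsilon> f T < \<infinity>) \<longrightarrow>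
        (\<forall>\<epsilon>' \<epsilon>. 0 < \<epsilon>' \<and> \<epsilon>' < \<epsilon> \<longrightarrow>
           limsup (\<lambda>j. eps_variation \<epsilon> (F j) T) \<le> eps_variation_left \<epsilon> f T \<and>
           eps_variation_left \<epsilon> f T \<le> eps_variation \<epsilon>' f T \<and>
           eps_variation \<epsilon>' f T < \<infinity>))
     \<and>
     \<comment> \<open>non-necessity: some choice of domain and metric space admits a counterexample\<close>
     (\<exists>(S :: real set) (F :: nat \<Rightarrow> real \<Rightarrow> real) f.
        S \<noteq> {} \<and> (\<forall>t\<in>S. (\<lambda>j. F j t) \<longlonglongrightarrow> f t) \<and> \<not> limsup_eps_variation_finite F S)
     \<and>
     \<comment> \<open>non-necessity for the given \<open>T\<close> and \<open>M\<close>, excluding the degenerate cases where it fails\<close>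
     (infinite T \<and> (\<exists>x y :: 'm. x \<noteq> y) \<longrightarrow>
        (\<exists>(F :: nat \<Rightarrow> real \<Rightarrow> 'm) f.
           (\<forall>t\<in>T. (\<lambda>j. F j t) \<longlonglongrightarrow> f t) \<and> \<not> limsup_eps_variation_finite F T))
     \<and>
     \<comment> \<open>almost necessity; convergence everywhere on \<open>T\<close> is a special case of \<open>AE\<close>\<close>
     (\<forall>(F :: nat \<Rightarrow> real \<Rightarrow> 'm) f.
        T \<in> sets lebesgue \<and> emeasure lebesgue T < \<infinity> \<and>
        (\<forall>j. F j \<in> borel_measurable (lebesgue_on T)) \<and>
        (AE t in lebesgue_on T. (\<lambda>j. F j t) \<longlonglongrightarrow> f t) \<and>
        (\<forall>\<epsilon>>0. eps_variation \<epsilon> f T < \<infinity>) \<longrightarrow>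
        (\<forall>\<eta>>0. \<exists>T\<^sub>\<eta>.
           T\<^sub>\<eta> \<in> sets lebesgue \<and> T\<^sub>\<eta> \<subseteq> T \<and>
           emeasure lebesgue (T - T\<^sub>\<eta>) \<le> ennreal \<eta> \<and>
           uniform_limit T\<^sub>\<eta> F f sequentially \<and>
           (\<forall>\<epsilon>' \<epsilon>. 0 < \<epsilon>' \<and> \<epsilon>' < \<epsilon> \<longrightarrow>
              limsup (\<lambda>j. eps_variation \<epsilon> (F j) T\<^sub>\<eta>) \<le> eps_variation \<epsilon>' f T\<^sub>\<eta> \<and>
              eps_variation \<epsilon>' f T\<^sub>\<eta> \<le> eps_variation \<epsilon>' f T \<and>
              eps_variation \<epsilon>' f T < \<infinity>)))"
proof (intro conjI allI impI)
  fix F :: "nat \<Rightarrow> real \<Rightarrow> 'm" and f \<epsilon>' \<epsilon>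
  assume A: "uniform_limit T F f sequentially \<and> (\<forall>\<epsilon>>0. eps_variation \<epsilon> f T < \<infinity>)"
    and e: "0 < \<epsilon>' \<and> \<epsilon>' < (\<epsilon>::real)"
  show "limsup (\<lambda>j. eps_variation \<epsilon> (F j) T) \<le> eps_variation_left \<epsilon> f T"
    using A e by (intro limsup_eps_variation_le_left) auto
  show "eps_variation_left \<epsilon> f T \<le> eps_variation \<epsilon>' f T"
    using e by (intro eps_variation_left_le) simp
  show "eps_variation \<epsilon>' f T < \<infinity>" using A e by blast
next
  obtain F :: "nat \<Rightarrow> real \<Rightarrow> real" and f
    where F: "\<forall>t\<in>UNIV. (\<lambda>j. F j t) \<longlonglongrightarrow> f t" "\<not> limsup_eps_variation_finite F UNIV"
    using pointwise_limit_infinite_eps_variation[of UNIV "0::real" 1,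
        OF infinite_UNIV_char_0 zero_neq_one] by blast
  show "\<exists>(S :: real set) (F :: nat \<Rightarrow> real \<Rightarrow> real) f.
        S \<noteq> {} \<and> (\<forall>t\<in>S. (\<lambda>j. F j t) \<longlonglongrightarrow> f t) \<and> \<not> limsup_eps_variation_finite F S"
    by (intro exI[of _ UNIV] exI[of _ F] exI[of _ f] conjI F UNIV_not_empty)
next
  assume "infinite T \<and> (\<exists>x y :: 'm. x \<noteq> y)"
  then show "\<exists>(F :: nat \<Rightarrow> real \<Rightarrow> 'm) f.
           (\<forall>t\<in>T. (\<lambda>j. F j t) \<longlonglongrightarrow> f t) \<and> \<not> limsup_eps_variation_finite F T"
    using pointwise_limit_infinite_eps_variation by blast
next
  fix F :: "nat \<Rightarrow> real \<Rightarrow> 'm" and f and \<eta> :: real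
  assume A: "T \<in> sets lebesgue \<and> emeasure lebesgue T < \<infinity> \<and>
        (\<forall>j. F j \<in> borel_measurable (lebesgue_on T)) \<and>
        (AE t in lebesgue_on T. (\<lambda>j. F j t) \<longlonglongrightarrow> f t) \<and>
        (\<forall>\<epsilon>>0. eps_variation \<epsilon> f T < \<infinity>)"
    and "0 < \<eta>"
  then have T: "T \<in> sets lebesgue" "emeasure lebesgue T < \<infinity>"
    and meas: "F j \<in> borel_measurable (lebesgue_on T)"
    and lim: "AE t in lebesgue_on T. (\<lambda>j. F j t) \<longlonglongrightarrow> f t"
    and fin: "0 < \<epsilon> \<Longrightarrow> eps_variation \<epsilon> f T < \<infinity>" for j and \<epsilon> :: real
    by blast+
  obtain B where B: "B \<in> sets lebesgue" "B \<subseteq> T"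
      "emeasure lebesgue (T - B) \<le> ennreal \<eta>" "uniform_limit B F f sequentially"
    using Egorov_finite_eps_variation[OF T meas lim fin \<open>0 < \<eta>\<close>] by blast
  show "\<exists>T\<^sub>\<eta>.
           T\<^sub>\<eta> \<in> sets lebesgue \<and> T\<^sub>\<eta> \<subseteq> T \<and>
           emeasure lebesgue (T - T\<^sub>\<eta>) \<le> ennreal \<eta> \<and>
           uniform_limit T\<^sub>\<eta> F f sequentially \<and>
           (\<forall>\<epsilon>' \<epsilon>. 0 < \<epsilon>' \<and> \<epsilon>' < \<epsilon> \<longrightarrow>
              limsup (\<lambda>j. eps_variation \<epsilon> (F j) T\<^sub>\<eta>) \<le> eps_variation \<epsilon>' f T\<^sub>\<eta> \<and>
              eps_variation \<epsilon>' f T\<^sub>\<eta> \<le> eps_variation \<epsilon>' f T \<and>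
              eps_variation \<epsilon>' f T < \<infinity>)"
  proof (intro exI[of _ B] conjI allI impI)
    fix \<epsilon>' \<epsilon> :: real assume e: "0 < \<epsilon>' \<and> \<epsilon>' < \<epsilon>"
    show "limsup (\<lambda>j. eps_variation \<epsilon> (F j) B) \<le> eps_variation \<epsilon>' f B"
      using B(4) conjunct1[OF e] conjunct2[OF e] by (rule limsup_eps_variation_le)
    show "eps_variation \<epsilon>' f B \<le> eps_variation \<epsilon>' f T"
      using B(2) by (rule eps_variation_mono_set)
    show "eps_variation \<epsilon>' f T < \<infinity>" using fin e by blast
  qed (fact B)+
qed

end
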